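(* Let $G$ be a connected bipartite $L_1$-graph with maximum degree greater than $2$. Then either $G$ is a complete bipartite graph $K_{n,n}$, or $G$ is obtained from $K_{n,n}$ by removing a single vertex, a single edge, or a perfect matching.
   Context: All graphs are simple. $N(u)$ denotes the neighborhood of $u$, $d(u)=|N(u)|$, and $d(u,v)$ the distance. A graph $G$ is an $L_1$-graph if $d(u)+d(v)\ge |N(u)\cup N(v)\cup N(w)|-1$ for every triple of vertices $u,v,w$ with $d(u,v)=2$ and $w\in N(u)\cap N(v)$. *)

theory Defs
  imports "Graph_Theory.Graph_Theory" "HOL-Library.Extended_Nat"
begin

text \<open>
  A simple graph is represented by a loop-free symmetric digraph without parallel arcs: the
  edge \<open>{u, v}\<close> corresponds to the two arcs \<open>(u, v)\<close> and \<open>(v, u)\<close>.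
  Infinite graphs are allowed.
\<close>

abbreviation simple_graph :: "'a pair_pre_digraph \<Rightarrow> bool" where
  "simple_graph \<equiv> pair_bidirected_digraph"

definition nbhd :: "'a pair_pre_digraph \<Rightarrow> 'a \<Rightarrow> 'a set" where
  "nbhd G u = {v. (u, v) \<in> parcs G}"

definition degree :: "'a pair_pre_digraph \<Rightarrow> 'a \<Rightarrow> nat" where
  "degree G u = card (nbhd G u)"

definition locally_finite :: "'a pair_pre_digraph \<Rightarrow> bool" where
  "locally_finite G \<longleftrightarrow> (\<forall>u\<in>pverts G. finite (nbhd G u))"

text \<open>
  The supremum is taken in \<open>enat\<close>, so it is the usual maximum for finite graphs and
  \<open>\<infinity>\<close> for locally finite graphs of unbounded degree.
\<close>

definition max_degree :: "'a pair_pre_digraph \<Rightarrow> enat" where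
  "max_degree G = (SUP u\<in>pverts G. enat (degree G u))"

definition distance :: "'a pair_pre_digraph \<Rightarrow> 'a \<Rightarrow> 'a \<Rightarrow> ereal" where
  "distance G = wf_digraph.\<mu> (with_proj G) (\<lambda>_. 1)"

definition bipartite :: "'a pair_pre_digraph \<Rightarrow> bool" where
  "bipartite G \<longleftrightarrow> (\<exists>X Y. pverts G = X \<union> Y \<and> X \<inter> Y = {} \<and> parcs G \<subseteq> X \<times> Y \<union> Y \<times> X)"

definition L1_graph :: "'a pair_pre_digraph \<Rightarrow> bool" where
  "L1_graph G \<longleftrightarrow>
    (\<forall>u\<in>pverts G. \<forall>v\<in>pverts G. \<forall>w\<in>pverts G.
       distance G u v = 2 \<and> w \<in> nbhd G u \<inter> nbhd G v \<longrightarrow>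
         int (degree G u) + int (degree G v) \<ge> int (card (nbhd G u \<union> nbhd G v \<union> nbhd G w)) - 1)"

definition delete_edges :: "'a rel \<Rightarrow> 'a pair_pre_digraph \<Rightarrow> 'a pair_pre_digraph" where
  "delete_edges M G = G\<lparr>parcs := parcs G - (M \<union> M\<inverse>)\<rparr>"

text \<open>Like the edge set of a graph, a matching is given as a symmetric relation.\<close>

definition perfect_matching :: "'a pair_pre_digraph \<Rightarrow> 'a rel \<Rightarrow> bool" where
  "perfect_matching G M \<longleftrightarrow> M \<subseteq> parcs G \<and> sym M \<and> (\<forall>u\<in>pverts G. \<exists>!v. (u, v) \<in> M)"

end

theory Submission
  imports Defs
begin

text \<open>
  If \<open>w\<close> is a common neighbour of \<open>u \<noteq> v\<close> in a bipartite graph, then \<open>N(w)\<close> is disjoint from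
  \<open>N(u) \<union> N(v)\<close>, so the \<open>L\<^sub>1\<close> condition reads \<open>|N(w)| \<le> |N(u) \<inter> N(v)| + 1\<close>. Counting along a
  shortest path of length 4 shows that every vertex on the side of a vertex \<open>a\<close> of degree at least 3
  shares a neighbour with \<open>a\<close>; hence the graph is finite and \<open>a\<close> can be chosen of maximum degree.
  A vertex on its side then misses at most one neighbour of \<open>a\<close>. If \<open>N(a)\<close> is the whole opposite side,
  the graph is \<open>K\<^bsub>n,n\<^esub>\<close>, possibly without a vertex or an edge. Otherwise any vertex
  \<open>b\<close> outside \<open>N(a)\<close> on the opposite side is adjacent to every vertex on the side of \<open>a\<close> except
  \<open>a\<close> itself, so \<open>b\<close> is unique, and the non-edges between the two sides
  form a perfect matching.
\<close>

section \<open>Shared neighbours and finiteness\<close>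

text \<open>Connectivity is encoded as an induction principle, so the counting arguments need no
  walks. Only neighbourhoods are assumed finite; the sides turn out finite once some degree is at
  least 3.\<close>

locale bipartite_L1 =
  fixes X Y :: "'a set" and N :: "'a \<Rightarrow> 'a set"
  assumes disjoint: "X \<inter> Y = {}"
    and nbr_sides: "y \<in> N x \<Longrightarrow> x \<in> X \<and> y \<in> Y \<or> x \<in> Y \<and> y \<in> X"
    and nbr_sym: "y \<in> N x \<Longrightarrow> x \<in> N y"
    and finite_nbr [simp]: "finite (N x)"
    and L1: "u \<noteq> v \<Longrightarrow> w \<in> N u \<Longrightarrow> w \<in> N v \<Longrightarrow> card (N w) \<le> card (N u \<inter> N v) + 1"
    and connected: "a \<in> S \<Longrightarrow> a \<in> X \<union> Y \<Longrightarrow> (\<And>x y. x \<in> S \<Longrightarrow> y \<in> N x \<Longrightarrow> y \<in> S) \<Longrightarrow> X \<union> Y \<subseteq> S"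
begin

lemma swap: "bipartite_L1 Y X N"
proof
  show "Y \<union> X \<subseteq> S" if "a \<in> S" "a \<in> Y \<union> X" "\<And>x y. x \<in> S \<Longrightarrow> y \<in> N x \<Longrightarrow> y \<in> S" for a S
    using connected[of a S] that by (simp add: Un_commute)
qed (use disjoint nbr_sides nbr_sym L1 in auto)

lemma X_nbr: "x \<in> X \<Longrightarrow> y \<in> N x \<Longrightarrow> y \<in> Y"
  and Y_nbr: "y \<in> Y \<Longrightarrow> x \<in> N y \<Longrightarrow> x \<in> X"
  using disjoint nbr_sides by blast+

text \<open>A counterexample gives a path a - u - x - y - z whose ends share no neighbour.
  \<open>L1\<close> at \<open>x\<close>, \<open>u\<close> and \<open>y\<close> then leaves
  \<open>u\<close> as the only common neighbour of \<open>x\<close> and \<open>a\<close>, while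
  \<open>L1\<close> at \<open>a\<close>, whose degree is at least 3, produces a second one.\<close>

lemma two_steps:
  assumes a: "3 \<le> card (N a)"
    and x: "x = a \<or> N x \<inter> N a \<noteq> {}" and y: "y \<in> N x" and z: "z \<in> N y"
  shows "z = a \<or> N z \<inter> N a \<noteq> {}"
proof (rule ccontr)
  assume "\<not> ?thesis"
  then have z': "z \<noteq> a" "N z \<inter> N a = {}" by auto
  have yz: "y \<in> N z" using z nbr_sym by blast
  have ya: "y \<notin> N a" "a \<notin> N y" using yz z' nbr_sym by blast+
  have xa: "x \<noteq> a" using y ya by blast
  then obtain u where u: "u \<in> N x" "u \<in> N a" using x by blast
  have xz: "x \<noteq> z" using u z' by blast
  have uy: "u \<noteq> y" using u ya by blast
  have ux: "x \<in> N u" "x \<in> N y" "a \<in> N u" using u y nbr_sym by blast+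
  have zu: "z \<notin> N u" using u(2) z' nbr_sym by blast
  have "card (N x) \<le> card (N u \<inter> N y) + 1" using L1[OF uy] ux by blast
  moreover have "card (N u \<inter> N y) < card (N u)" "card (N u \<inter> N y) < card (N y)"
    using ux ya zu z by (auto intro!: psubset_card_mono)
  moreover have "card (N u) \<le> card (N x \<inter> N a) + 1" using L1[of x a u] xa u by blast
  moreover have "card (N y) \<le> card (N x \<inter> N z) + 1" using L1[of x z y] xz y yz by blast
  moreover have "card (N x \<inter> N a) + card (N x \<inter> N z) = card ((N x \<inter> N a) \<union> (N x \<inter> N z))"
    using z' by (intro card_Un_disjoint[symmetric]) auto
  moreover have "card ((N x \<inter> N a) \<union> (N x \<inter> N z)) \<le> card (N x)"
    by (intro card_mono) auto
  \<comment> \<open>Put s = |N u \<inter> N y|. Both |N x \<inter> N a| and |N x \<inter> N z| are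
    at least s, and their sum is at most |N x| \<le> s + 1; hence s \<le> 1 and all three bounds
    follow.\<close>
  ultimately have small: "card (N x) \<le> 2" "card (N x \<inter> N a) \<le> 1" "card (N u) \<le> 2"
    by linarith+
  have "\<not> N a \<subseteq> {u}" using a card_mono[of "{u}" "N a"] by auto
  then obtain u' where u': "u' \<in> N a" "u' \<noteq> u" by blast
  have "card (N a) \<le> card (N u \<inter> N u') + 1" using L1[of u u' a] u' u nbr_sym by metis
  then have "card (N u) \<le> card (N u \<inter> N u')" using a small by linarith
  then have "N u \<inter> N u' = N u" by (intro card_seteq) auto
  then have "u' \<in> N x" using ux nbr_sym by blast
  then have "{u, u'} \<subseteq> N x \<inter> N a" using u u' by blast
  then have "card {u, u'} \<le> card (N x \<inter> N a)" by (intro card_mono) auto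
  then show False using u' small by simp
qed

text \<open>By \<open>two_steps\<close>, \<open>a\<close> and the vertices sharing a neighbour with
  it form a set closed under two steps. Together with its neighbours it is closed under adjacency,
  hence the whole graph; as it lies in \<open>X\<close>, it is all of \<open>X\<close>.\<close>

lemma common_nbr:
  assumes "3 \<le> card (N a)" "a \<in> X" "x \<in> X"
  shows "x = a \<or> N x \<inter> N a \<noteq> {}"
    and "y \<in> Y \<Longrightarrow> \<exists>w\<in>X. y \<in> N w"
proof -
  define R where "R = {x. x = a \<or> N x \<inter> N a \<noteq> {}}"
  have RX: "R \<subseteq> X" using \<open>a \<in> X\<close> disjoint nbr_sides unfolding R_def by blast
  have "X \<union> Y \<subseteq> R \<union> (\<Union>x\<in>R. N x)"
  proof (rule connected)
    fix x y assume xy: "x \<in> R \<union> (\<Union>x\<in>R. N x)" "y \<in> N x"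
    show "y \<in> R \<union> (\<Union>x\<in>R. N x)"
      using xy two_steps[OF assms(1)] unfolding R_def by blast
  qed (use \<open>a \<in> X\<close> in \<open>auto simp: R_def\<close>)
  then have "x \<in> R" "y \<in> Y \<Longrightarrow> y \<in> (\<Union>x\<in>R. N x)" for y
    using RX X_nbr disjoint \<open>x \<in> X\<close> by blast+
  then show "x = a \<or> N x \<inter> N a \<noteq> {}" "y \<in> Y \<Longrightarrow> \<exists>w\<in>X. y \<in> N w"
    using RX unfolding R_def by auto
qed

lemma finite_sides:
  assumes "3 \<le> card (N a)" "a \<in> X"
  shows "finite X" "finite Y"
proof -
  have "X \<subseteq> insert a (\<Union>u\<in>N a. N u)" using common_nbr(1)[OF assms] nbr_sym by blast
  then show "finite X" by (rule finite_subset) simp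
  have "Y \<subseteq> (\<Union>x\<in>X. N x)" using common_nbr(2)[OF assms assms(2)] by blast
  then show "finite Y" by (rule finite_subset) (simp add: \<open>finite X\<close>)
qed

end

section \<open>Structure around a vertex of maximum degree\<close>

text \<open>\<open>X\<close> names the side of \<open>a\<close>, but \<open>max\<close> ranges over
  both sides, so it also bounds the degrees of the neighbours of \<open>a\<close>.\<close>

locale bipartite_L1_max = bipartite_L1 +
  fixes a
  assumes aX: "a \<in> X" and max: "card (N z) \<le> card (N a)" and deg3: "3 \<le> card (N a)"
begin

lemma finX: "finite X" and finY: "finite Y"
  using finite_sides[OF deg3 aX] by auto

lemma nbr_avoiding:
  assumes "finite S" "card S < card (N a)"
  obtains v where "v \<in> N a" "v \<notin> S"
  using assms card_mono[of S "N a"] by fastforce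

text \<open>\<open>L1\<close> at \<open>a\<close> bounds |N a| by |N u \<inter> N v| + 1, and
  \<open>x\<close> lies in \<open>N u\<close> but not in \<open>N v\<close>, which absorbs the extra
  1.\<close>

lemma degree_eq:
  assumes x: "u \<in> N x" and u: "u \<in> N a" and v: "v \<in> N a" "v \<notin> N x"
  shows "card (N u) = card (N a)"
proof -
  have "card (N a) \<le> card (N u \<inter> N v) + 1" using L1[of u v a] u v x nbr_sym by blast
  moreover have "card (N u \<inter> N v) < card (N u)"
    using x v nbr_sym by (intro psubset_card_mono[OF finite_nbr]) blast
  ultimately show ?thesis using max[of u] by linarith
qed

text \<open>If \<open>x\<close> misses some neighbour of \<open>a\<close>, then a common neighbour
  \<open>u\<close> of \<open>x\<close> and \<open>a\<close> has maximum degree by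
  \<open>degree_eq\<close>, and \<open>L1\<close> at \<open>u\<close> gives the bound.\<close>

lemma misses_le_1:
  assumes "x \<in> X"
  shows "card (N a) \<le> card (N x \<inter> N a) + 1"
proof (cases "N a \<subseteq> N x")
  case True
  then show ?thesis by (simp add: Int_absorb1)
next
  case False
  then obtain v where v: "v \<in> N a" "v \<notin> N x" by blast
  then have "x \<noteq> a" by blast
  then obtain u where u: "u \<in> N x" "u \<in> N a" using common_nbr(1)[OF deg3 aX assms] by blast
  show ?thesis using L1[of x a u] degree_eq[OF u v] u \<open>x \<noteq> a\<close> by simp
qed

lemma misses_unique:
  assumes "x \<in> X" "v \<in> N a - N x" "v' \<in> N a - N x"
  shows "v = v'"
proof -
  have "card (N a - N x) = card (N a) - card (N x \<inter> N a)"
    by (simp add: card_Diff_subset_Int Int_commute)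
  then have "card (N a - N x) \<le> 1" using misses_le_1[OF assms(1)] by linarith
  then show ?thesis using assms by (metis card_le_Suc0_iff_eq finite_Diff finite_nbr One_nat_def)
qed

lemma degree_ge:
  assumes "u \<in> N a"
  shows "card (N a) \<le> card (N u) + 1"
proof -
  obtain v where v: "v \<in> N a" "v \<noteq> u" using nbr_avoiding[of "{u}"] deg3 by auto
  have "card (N a) \<le> card (N u \<inter> N v) + 1" using L1[of u v a] v assms nbr_sym by metis
  also have "card (N u \<inter> N v) \<le> card (N u)" by (intro card_mono) auto
  finally show ?thesis by simp
qed

text \<open>If some \<open>x\<close> misses \<open>u\<close>, it sees all other neighbours of
  \<open>a\<close>, which therefore have maximum degree. When |X| \<le> |N a| they see all of
  \<open>X\<close>, and \<open>u\<close> misses only \<open>x\<close>; a larger \<open>X\<close> is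
  contradictory.\<close>

lemma dominating:
  assumes Y: "Y = N a"
  shows "(\<forall>x\<in>X. N x = Y) \<and> (card X = card Y \<or> card X + 1 = card Y) \<or>
    card X = card Y \<and> (\<exists>x0\<in>X. \<exists>y0\<in>Y. \<forall>x\<in>X. \<forall>y\<in>Y. y \<in> N x \<longleftrightarrow> (x, y) \<noteq> (x0, y0))"
proof (cases "\<forall>x\<in>X. N x = Y")
  case True
  have "N a \<noteq> {}" using deg3 by auto
  then obtain u where u: "u \<in> N a" by blast
  have "N u = X" using True u Y Y_nbr[of u] nbr_sym by blast
  then show ?thesis using True degree_ge[OF u] max[of u] Y by auto
next
  case False
  then obtain x u where x: "x \<in> X" "u \<in> N a" "u \<notin> N x" using X_nbr Y by blast
  have deg: "card (N v) = card (N a)" if "v \<in> N a" "v \<noteq> u" for v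
    using degree_eq[of v x u] misses_unique[OF x(1), of u v] x that by blast
  have NX: "N v \<subseteq> X" if "v \<in> N a" for v using that Y Y_nbr by blast
  show ?thesis
  proof (cases "card X \<le> card (N a)")
    case True
    have full: "N v = X" if "v \<in> N a" "v \<noteq> u" for v
      using deg[OF that] NX[OF that(1)] True finX by (intro card_seteq) auto
    obtain v where v: "v \<in> N a" "v \<noteq> u" using nbr_avoiding[of "{u}"] deg3 by auto
    have cX: "card X = card (N a)" using deg[OF v] full[OF v] by simp
    have "card (X - N u) \<le> 1"
      using degree_ge[OF x(2)] cX NX[OF x(2)] by (simp add: card_Diff_subset)
    then have uniq: "x' = x" if "x' \<in> X" "x' \<notin> N u" for x'
      using that x finX nbr_sym by (metis card_le_Suc0_iff_eq finite_Diff One_nat_def DiffI)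
    have "y \<in> N x' \<longleftrightarrow> (x', y) \<noteq> (x, u)" if "x' \<in> X" "y \<in> Y" for x' y
      using full[of y] uniq[of x'] that x nbr_sym Y by blast
    then show ?thesis using x Y cX by blast
  next
    case False
    \<comment> \<open>Impossible: two vertices missing different neighbours of \<open>a\<close> have too few common neighbours.\<close>
    have deg': "card (N v) = card (N a)" if v: "v \<in> N a" for v
    proof (cases "v = u")
      case True
      \<comment> \<open>The degree of \<open>w\<close> is |N a| < |X|, so some \<open>x'\<close>
        misses \<open>w\<close>; it cannot also miss \<open>u\<close>, and \<open>degree_eq\<close>
        applies to \<open>u\<close>.\<close>
      obtain w where w: "w \<in> N a" "w \<noteq> u" using nbr_avoiding[of "{u}"] deg3 by auto
      have "\<not> X \<subseteq> N w" using deg[OF w] False card_mono[of "N w" X] by auto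
      then obtain x' where x': "x' \<in> X" "x' \<notin> N w" by blast
      show ?thesis
        using degree_eq[of u x' w] misses_unique[OF x'(1), of w u] x' x w True nbr_sym by blast
    qed (use deg v in blast)
    have missed: "\<exists>x'\<in>X. v \<notin> N x'" if v: "v \<in> N a" for v
    proof -
      have "\<not> X \<subseteq> N v" using deg'[OF v] False card_mono[of "N v" X] by auto
      then show ?thesis using nbr_sym by blast
    qed
    obtain u1 where u1: "u1 \<in> N a" using x by blast
    obtain u2 where u2: "u2 \<in> N a" "u2 \<noteq> u1" using nbr_avoiding[of "{u1}"] deg3 by auto
    obtain u3 where u3: "u3 \<in> N a" "u3 \<noteq> u1" "u3 \<noteq> u2" using nbr_avoiding[of "{u1, u2}"] deg3 u2 by auto
    obtain x1 x2 where x12: "x1 \<in> X" "u1 \<notin> N x1" "x2 \<in> X" "u2 \<notin> N x2"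
      using missed u1 u2 by blast
    \<comment> \<open>Each of \<open>x1\<close>, \<open>x2\<close> misses just one neighbour of
      \<open>a\<close>, so both see \<open>u3\<close>. The fact \<open>u2 \<in> N x1\<close> shows
      that they differ. \<open>L1\<close> at \<open>u3\<close> then yields |N a| \<le> |N a| - 2 +
      1.\<close>
    have nb: "u3 \<in> N x1" "u3 \<in> N x2" "u2 \<in> N x1"
      using misses_unique[OF x12(1), of u1] misses_unique[OF x12(3), of u2] x12 u1 u2 u3 by blast+
    have "card (N u3) \<le> card (N x1 \<inter> N x2) + 1" using L1[of x1 x2 u3] nb x12 by blast
    moreover have "N x1 \<inter> N x2 \<subseteq> N a - {u1, u2}" using x12 X_nbr Y by blast
    then have "card (N x1 \<inter> N x2) \<le> card (N a - {u1, u2})" by (intro card_mono) auto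
    moreover have "card (N a - {u1, u2}) = card (N a) - 2"
      using u1 u2 by (subst card_Diff_subset) auto
    ultimately show ?thesis using deg'[OF u3(1)] deg3 by linarith
  qed
qed

text \<open>By \<open>misses_le_1\<close>, \<open>b\<close> and the common neighbours of
  \<open>x\<close> and \<open>a\<close> already number at least |N a|, so maximality leaves no room
  for others. Nor can \<open>x\<close> see all of \<open>N a\<close> besides
  \<open>b\<close>.\<close>

lemma outer_nbr:
  assumes b: "b \<notin> N a" and x: "x \<in> N b" "x \<in> X"
  obtains u where "u \<in> N a" "N x = insert b (N a - {u})"
proof -
  have bx: "b \<in> N x" using x nbr_sym by blast
  have sub: "insert b (N x \<inter> N a) \<subseteq> N x" using bx by blast
  have "card (N x) \<le> card (insert b (N x \<inter> N a))"
    using b misses_le_1[OF x(2)] max[of x] by simp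
  then have eq: "N x = insert b (N x \<inter> N a)" using sub by (metis card_seteq finite_nbr)
  have "\<not> N a \<subseteq> N x"
  proof
    assume "N a \<subseteq> N x"
    then have "N a \<subset> N x" using b bx by blast
    then show False using max[of x] psubset_card_mono[of "N x" "N a"] by simp
  qed
  then obtain u where u: "u \<in> N a" "u \<notin> N x" by blast
  then have "N a - {u} = N x \<inter> N a" using misses_unique[OF x(2), of u] by blast
  then show ?thesis using that u eq by metis
qed

text \<open>Fix a neighbour \<open>x\<close> of \<open>b\<close>. It has maximum degree and at least
  two common neighbours with \<open>a\<close>; since \<open>y\<close> misses at most one of these,
  some \<open>v\<close> is adjacent to \<open>a\<close>, \<open>x\<close> and \<open>y\<close>.
  \<open>L1\<close> at \<open>x\<close> for \<open>v\<close> and \<open>b\<close> forces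
  \<open>b\<close> to see every neighbour of \<open>v\<close> except \<open>a\<close>.\<close>

lemma outer_dominating:
  assumes b: "b \<in> Y" "b \<notin> N a"
  shows "N b = X - {a}"
proof -
  obtain x where x: "x \<in> X" "b \<in> N x" using common_nbr(2)[OF deg3 aX aX b(1)] by blast
  then have xb: "x \<in> N b" using nbr_sym by blast
  obtain u where u: "u \<in> N a" "N x = insert b (N a - {u})"
    using outer_nbr[OF b(2) xb x(1)] .
  have cx: "card (N x) = card (N a)" using u b card_gt_0_iff[of "N a"] by auto
  have "y \<in> N b" if y: "y \<in> X" "y \<noteq> a" for y
  proof -
    have "card (N a - {u}) \<ge> 2" using u deg3 by simp
    then have "\<not> N a - {u} \<subseteq> N a - N y"
      using misses_unique[OF y(1)] card_le_Suc0_iff_eq[of "N a - {u}"]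
      by (metis One_nat_def finite_Diff finite_nbr not_less_eq_eq numeral_2_eq_2 subsetD)
    then obtain v where v: "v \<in> N a" "v \<noteq> u" "v \<in> N y" by blast
    have "card (N x) \<le> card (N v \<inter> N b) + 1"
      using L1[of v b x] v u b xb nbr_sym by blast
    moreover have "a \<in> N v" "a \<notin> N b" using v b nbr_sym by blast+
    moreover have "card (N v - {a}) + 1 = card (N v)"
      using \<open>a \<in> N v\<close> by (metis Suc_eq_plus1 card_Suc_Diff1 finite_nbr)
    ultimately have "N v \<inter> N b = N v - {a}"
      using cx max[of v] by (intro card_seteq) auto
    then show "y \<in> N b" using v y nbr_sym by blast
  qed
  then show ?thesis using b Y_nbr nbr_sym by blast
qed

lemma not_dominating:
  assumes "Y \<noteq> N a"
  shows "card X = card Y \<and> (\<forall>x\<in>X. \<exists>!y. y \<in> Y \<and> y \<notin> N x) \<and> (\<forall>y\<in>Y. \<exists>!x. x \<in> X \<and> y \<notin> N x)"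
proof -
  obtain b where b: "b \<in> Y" "b \<notin> N a" using assms X_nbr aX by blast
  have Nb: "N b = X - {a}" using outer_dominating[OF b] .
  obtain x where x: "x \<in> X" "b \<in> N x" using common_nbr(2)[OF deg3 aX aX b(1)] by blast
  then have xb: "x \<in> N b" "x \<noteq> a" using b nbr_sym by blast+
  obtain u where u: "u \<in> N a" "N x = insert b (N a - {u})"
    using outer_nbr[OF b(2) xb(1) x(1)] .
  \<comment> \<open>A second outer vertex would also be adjacent to \<open>x\<close>, but
    \<open>x\<close> has only one neighbour outside \<open>N a\<close>.\<close>
  have "b' = b" if "b' \<in> Y" "b' \<notin> N a" for b'
    using outer_dominating[OF that] xb x u that nbr_sym[of x b'] by blast
  then have Y: "Y = insert b (N a)" using b X_nbr aX by blast
  have ymiss: "\<exists>v\<in>N a. N y = insert b (N a - {v})" if y: "y \<in> X" "y \<noteq> a" for y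
  proof -
    have "y \<in> N b" using Nb y by simp
    from outer_nbr[OF b(2) this y(1)] show ?thesis by blast
  qed
  \<comment> \<open>Some neighbour \<open>y\<close> of \<open>v\<close> other than \<open>a\<close>
    sees \<open>b\<close>, hence misses some \<open>w\<close> in \<open>N a\<close>;
    \<open>degree_eq\<close> then applies to \<open>v\<close>.\<close>
  have deg: "card (N v) = card (N a)" if v: "v \<in> N a" for v
  proof -
    have "\<not> N v \<subseteq> {a}" using degree_ge[OF v] deg3 card_mono[of "{a}" "N v"] by auto
    then obtain y where y: "y \<in> N v" "y \<noteq> a" by blast
    then have "y \<in> X" using v Y Y_nbr by blast
    then obtain w where w: "w \<in> N a" "N y = insert b (N a - {w})" using ymiss y by blast
    then have "w \<notin> N y" using b by auto
    then show ?thesis using degree_eq[of v y w] y(1) v w(1) nbr_sym by blast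
  qed
  have NX: "N v \<subseteq> X" if "v \<in> N a" for v using that Y Y_nbr by blast
  have "card X = card (N b) + 1" using Nb aX finX by (metis Suc_eq_plus1 card_Suc_Diff1)
  moreover have "u \<notin> N x" using u b by auto
  then have "N u \<subset> X" using NX[OF u(1)] x(1) nbr_sym by blast
  then have "card (N u) < card X" using finX by (intro psubset_card_mono)
  \<comment> \<open>The upper bound comes from |X| = |N b| + 1, the lower one from \<open>u\<close>,
    which has degree |N a| and misses \<open>x\<close>.\<close>
  ultimately have cX: "card X = card (N a) + 1" using deg[OF u(1)] max[of b] by linarith
  have "card X = card Y" using Y b cX by simp
  moreover have "\<exists>!y. y \<in> Y \<and> y \<notin> N x" if xX: "x \<in> X" for x
  proof (cases "x = a")
    case True
    then show ?thesis using Y b by blast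
  next
    case False
    then obtain v where v: "v \<in> N a" "N x = insert b (N a - {v})" using ymiss xX by blast
    show ?thesis by (rule ex1I[of _ v]) (use v Y b in auto)
  qed
  moreover have "\<exists>!x. x \<in> X \<and> y \<notin> N x" if "y \<in> Y" for y
  proof (cases "y = b")
    case True
    then show ?thesis using Nb aX nbr_sym by blast
  next
    case False
    then have y: "y \<in> N a" using that Y by blast
    have "card (X - N y) = 1" using deg[OF y] cX NX[OF y] by (simp add: card_Diff_subset)
    then obtain z where z: "X - N y = {z}" by (auto simp: card_1_singleton_iff)
    have "x \<in> X \<and> y \<notin> N x \<longleftrightarrow> x \<in> X - N y" for x using nbr_sym by blast
    then show ?thesis unfolding z by simp
  qed
  ultimately show ?thesis by blast
qed

end

section \<open>From graphs to neighbourhood functions\<close>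

lemma distance_eq_2:
  assumes "pair_wf_digraph G" and uv: "u \<noteq> v" "(u, v) \<notin> parcs G"
    and w: "(u, w) \<in> parcs G" "(w, v) \<in> parcs G"
  shows "distance G u v = 2"
proof -
  interpret pair_wf_digraph G by fact
  have cost: "awalk_cost (\<lambda>_. 1) p = real (length p)" for p
    by (induction p) auto
  have "\<mu> (\<lambda>_. 1) u v = 2"
  proof (rule antisym)
    have "awalk u [(u, w), (w, v)] v"
      using w by (auto simp: awalk_Cons_iff awalk_Nil_iff dest: in_arcsD2)
    then show "\<mu> (\<lambda>_. 1) u v \<le> 2"
      using min_cost_le_walk_cost[of u "[(u, w), (w, v)]" v "\<lambda>_. 1"] by (simp add: cost)
    \<comment> \<open>The case rule splits \<open>p\<close> into the empty, one-arc and longer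
      walks; \<open>uv\<close> excludes the first two.\<close>
    have "2 \<le> length p" if p: "awalk u p v" for p
      using p uv by (cases p rule: remdups_adj.cases) (auto simp: awalk_Cons_iff awalk_Nil_iff)
    then show "2 \<le> \<mu> (\<lambda>_. 1) u v"
      unfolding \<mu>_def by (intro INF_greatest) (auto simp: cost)
  qed
  then show ?thesis by (simp add: distance_def)
qed

lemma bipartite_L1_nbhd:
  assumes G: "simple_graph G" "locally_finite G" "Digraph_Component.connected (with_proj G)" "L1_graph G"
    and XY: "pverts G = X \<union> Y" "X \<inter> Y = {}" "parcs G \<subseteq> X \<times> Y \<union> Y \<times> X"
  shows "bipartite_L1 X Y (nbhd G)"
proof
  interpret pair_bidirected_digraph G by fact
  show "X \<inter> Y = {}" by fact
  show sides: "x \<in> X \<and> y \<in> Y \<or> x \<in> Y \<and> y \<in> X" if "y \<in> nbhd G x" for x y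
    using that XY by (auto simp: nbhd_def)
  show sym: "x \<in> nbhd G y" if "y \<in> nbhd G x" for x y
    using that pair_sym_arcs by (auto simp: nbhd_def symmetric_def sym_def)
  show fin: "finite (nbhd G x)" for x
  proof (cases "x \<in> pverts G")
    case False
    then have "nbhd G x = {}" by (auto simp: nbhd_def dest: in_arcsD1)
    then show ?thesis by simp
  qed (use \<open>locally_finite G\<close> in \<open>auto simp: locally_finite_def\<close>)
  show "card (nbhd G w) \<le> card (nbhd G u \<inter> nbhd G v) + 1"
    if uv: "u \<noteq> v" and w: "w \<in> nbhd G u" "w \<in> nbhd G v" for u v w
  proof -
    \<comment> \<open>Both are adjacent to \<open>w\<close>, hence on the same side, so their
      distance is exactly 2.\<close>
    have "v \<notin> nbhd G u" using sides[of w u] sides[of w v] sides[of v u] w XY(2) by blast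
    moreover have "v \<in> nbhd G w" using sym w by blast
    ultimately have "distance G u v = 2"
      using uv w distance_eq_2[of G u v w] pair_wf_digraph_axioms by (simp add: nbhd_def)
    moreover have "u \<in> pverts G" "v \<in> pverts G" "w \<in> pverts G"
      using w by (auto simp: nbhd_def dest: in_arcsD1 in_arcsD2)
    ultimately have "int (card (nbhd G u \<union> nbhd G v \<union> nbhd G w)) - 1
        \<le> int (card (nbhd G u)) + int (card (nbhd G v))"
      using w \<open>L1_graph G\<close> by (auto simp: L1_graph_def degree_def)
    moreover have "card (nbhd G u \<union> nbhd G v \<union> nbhd G w) = card (nbhd G u \<union> nbhd G v) + card (nbhd G w)"
    proof (intro card_Un_disjoint)
      show "(nbhd G u \<union> nbhd G v) \<inter> nbhd G w = {}"
        using sides[of _ u] sides[of _ v] sides[of _ w] w XY(2) by blast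
    qed (simp_all add: fin)
    moreover have "card (nbhd G u) + card (nbhd G v) = card (nbhd G u \<union> nbhd G v) + card (nbhd G u \<inter> nbhd G v)"
      by (intro card_Un_Int fin)
    ultimately show ?thesis by linarith
  qed
  show "X \<union> Y \<subseteq> S"
    if S: "a \<in> S" "a \<in> X \<union> Y" "\<And>x y. x \<in> S \<Longrightarrow> y \<in> nbhd G x \<Longrightarrow> y \<in> S" for a S
  proof
    fix z assume "z \<in> X \<union> Y"
    then have "a \<rightarrow>\<^sup>*\<^bsub>mk_symmetric G\<^esub> z"
      using \<open>Digraph_Component.connected (with_proj G)\<close> S(2) XY(1)
      by (auto simp: Digraph_Component.connected_def strongly_connected_def)
    then have "a \<rightarrow>\<^sup>*\<^bsub>with_proj G\<^esub> z"
      using reachable_mk_symmetric_eq[OF pair_sym_arcs] by simp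
    then show "z \<in> S"
      by (induction rule: reachable_induct) (use S in \<open>auto simp: nbhd_def\<close>)
  qed
qed

lemma digraph_iso_image:
  assumes "pair_wf_digraph G" "inj_on h (pverts G)"
  shows "digraph_iso (with_proj G)
    \<lparr>verts = h ` pverts G, arcs = map_prod h h ` parcs G, tail = fst, head = snd\<rparr>"
proof -
  interpret pair_wf_digraph G by fact
  let ?f = "\<lparr>iso_verts = h, iso_arcs = map_prod h h, iso_head = snd, iso_tail = fst\<rparr>"
  have "inj_on (map_prod h h) (parcs G)"
    using map_prod_inj_on[OF assms(2) assms(2)] by (rule inj_on_subset) (auto dest: in_arcsD1 in_arcsD2)
  then have "pre_digraph.digraph_isomorphism (with_proj G) ?f"
    using assms wf_digraph_wp_iff[of G] by (auto simp: pre_digraph.digraph_isomorphism_def)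
  then show ?thesis
    unfolding digraph_iso_def by (intro exI[of _ ?f]) (simp add: app_iso_def)
qed

definition Knn :: "nat \<Rightarrow> nat pair_pre_digraph" where
  "Knn n = \<lparr>pverts = {..<2 * n}, parcs = {..<n} \<times> {n..<2 * n} \<union> {n..<2 * n} \<times> {..<n}\<rparr>"

lemma complete_bipartite_Knn: "K\<^bsub>n,n\<^esub> (with_proj (Knn n))"
  unfolding complete_bipartite_digraph_pair_def
proof (intro conjI exI)
  show "pverts (Knn n) = {..<n} \<union> {n..<2 * n}" by (auto simp: Knn_def)
qed (auto simp: Knn_def)

text \<open>Labels of \<open>Y\<close> start at \<open>card Y\<close>, not at \<open>card X\<close>.
  Thus if \<open>X\<close> is one vertex short, the label \<open>card X\<close> stays vacant and
  marks the vertex to delete from \<open>Knn (card Y)\<close>.\<close>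

lemma ex_labelling:
  assumes "finite X" "finite Y" "X \<inter> Y = {}" "card X \<le> card Y"
  obtains h :: "'a \<Rightarrow> nat"
  where "inj_on h (X \<union> Y)" "h ` X = {..<card X}" "h ` Y = {card Y..<2 * card Y}"
proof -
  obtain f where f: "bij_betw f X {..<card X}"
    using ex_bij_betw_finite_nat[OF assms(1)] atLeast0LessThan by metis
  obtain g where g: "bij_betw g Y {card Y..<2 * card Y}"
    using finite_same_card_bij[OF assms(2), of "{card Y..<2 * card Y}"] by auto
  define h where "h x = (if x \<in> X then f x else g x)" for x
  have X: "bij_betw h X {..<card X}"
    using f by (rule bij_betw_cong[THEN iffD1, rotated]) (simp add: h_def)
  have Y: "bij_betw h Y {card Y..<2 * card Y}"
    using g by (rule bij_betw_cong[THEN iffD1, rotated]) (use assms(3) in \<open>auto simp: h_def\<close>)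
  have "bij_betw h (X \<union> Y) ({..<card X} \<union> {card Y..<2 * card Y})"
    using assms(4) by (intro bij_betw_combine[OF X Y]) auto
  then show ?thesis using that X Y by (auto simp: bij_betw_def)
qed

text \<open>\<open>D\<close> lists the missing edges, each oriented from \<open>X\<close> to
  \<open>Y\<close>; \<open>delete_edges\<close> removes the reverse arcs itself.\<close>

lemma iso_Knn_delete:
  assumes G: "pair_wf_digraph G" "pverts G = X \<union> Y"
    and h: "inj_on h (X \<union> Y)" "h ` X = {..<n}" "h ` Y = {n..<2 * n}"
    and D: "D \<subseteq> X \<times> Y" "parcs G = (X \<times> Y - D) \<union> (X \<times> Y - D)\<inverse>"
  shows "digraph_iso (with_proj G) (with_proj (delete_edges (map_prod h h ` D) (Knn n)))"
proof -
  have inj: "inj_on (map_prod h h) (X \<times> Y)"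
    using map_prod_inj_on[OF h(1) h(1)] by (rule inj_on_subset) auto
  have surj: "map_prod h h ` (X \<times> Y) = {..<n} \<times> {n..<2 * n}"
    using h by (simp add: map_prod_surj_on)
  have E: "map_prod h h ` (X \<times> Y - D) = {..<n} \<times> {n..<2 * n} - map_prod h h ` D"
    using inj_on_image_set_diff[OF inj, of "X \<times> Y" D] D(1) surj by auto
  have sub: "map_prod h h ` D \<subseteq> {..<n} \<times> {n..<2 * n}" using image_mono[OF D(1)] surj by metis
  have conv: "map_prod h h ` S\<inverse> = (map_prod h h ` S)\<inverse>" for S by force
  have "map_prod h h ` parcs G = ({..<n} \<times> {n..<2 * n} - map_prod h h ` D)
      \<union> ({..<n} \<times> {n..<2 * n} - map_prod h h ` D)\<inverse>"
    unfolding D(2) image_Un conv E ..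
  also have "\<dots> = parcs (delete_edges (map_prod h h ` D) (Knn n))"
    using sub by (fastforce simp: delete_edges_def Knn_def)
  finally have "map_prod h h ` parcs G = parcs (delete_edges (map_prod h h ` D) (Knn n))" .
  moreover have "h ` pverts G = pverts (delete_edges (map_prod h h ` D) (Knn n))"
    using G(2) h by (auto simp: delete_edges_def Knn_def image_Un)
  ultimately show ?thesis
    using digraph_iso_image[OF G(1), of h] h G(2) by (simp add: with_proj_def)
qed

definition near_complete_bipartite :: "'a pair_pre_digraph \<Rightarrow> bool" where
  "near_complete_bipartite G \<longleftrightarrow> (\<exists>n. \<exists>K :: nat pair_pre_digraph. K\<^bsub>n,n\<^esub> (with_proj K) \<and>
    (digraph_iso (with_proj G) (with_proj K)
     \<or> (\<exists>v\<in>pverts K. digraph_iso (with_proj G) (pre_digraph.del_vert (with_proj K) v))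
     \<or> (\<exists>e\<in>parcs K. digraph_iso (with_proj G) (with_proj (delete_edges {e} K)))
     \<or> (\<exists>M. perfect_matching K M \<and> digraph_iso (with_proj G) (with_proj (delete_edges M K)))))"

lemma near_complete_bipartiteI:
  assumes "pair_wf_digraph G" "pverts G = X \<union> Y" "finite X" "finite Y" "X \<inter> Y = {}"
    and D: "D \<subseteq> X \<times> Y" "parcs G = (X \<times> Y - D) \<union> (X \<times> Y - D)\<inverse>"
    and cases: "D = {} \<and> card X + 1 = card Y \<or>
      card X = card Y \<and> (D = {} \<or> (\<exists>e. D = {e}) \<or>
        (\<forall>x\<in>X. \<exists>!y. (x, y) \<in> D) \<and> (\<forall>y\<in>Y. \<exists>!x. (x, y) \<in> D))"
  shows "near_complete_bipartite G"
proof -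
  let ?n = "card Y" and ?K = "Knn (card Y)"
  obtain h where h: "inj_on h (X \<union> Y)" "h ` X = {..<card X}" "h ` Y = {?n..<2 * ?n}"
    using ex_labelling[of X Y] assms(3-5) cases by (metis le_add1 order_refl)
  show ?thesis
  proof (cases "card X = ?n")
    case False
    then have D0: "D = {}" and c: "card X + 1 = ?n" using cases by auto
    have "h ` pverts G = {..<2 * ?n} - {card X}"
      using c by (auto simp: assms(2) image_Un h)
    moreover have "map_prod h h ` parcs G = {..<card X} \<times> {?n..<2 * ?n} \<union> {?n..<2 * ?n} \<times> {..<card X}"
      unfolding D D0 by (simp add: image_Un converse_Times map_prod_surj_on[OF h(2) h(3)] map_prod_surj_on[OF h(3) h(2)])
    moreover have "\<dots> = {e \<in> parcs ?K. fst e \<noteq> card X \<and> snd e \<noteq> card X}"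
      unfolding c[symmetric] Knn_def by auto
    ultimately have "digraph_iso (with_proj G) (pre_digraph.del_vert (with_proj ?K) (card X))"
      using digraph_iso_image[OF assms(1), of h] h assms(2)
      by (simp add: pre_digraph.del_vert_def Knn_def)
    moreover have "card X \<in> pverts ?K" using c by (simp add: Knn_def)
    ultimately show ?thesis unfolding near_complete_bipartite_def using complete_bipartite_Knn by blast
  next
    case True
    then have hX: "h ` X = {..<?n}" using h by simp
    have iso: "digraph_iso (with_proj G) (with_proj (delete_edges (map_prod h h ` D) ?K))"
      using iso_Knn_delete[OF assms(1,2) h(1) hX h(3) D] .
    consider "D = {}" | e where "D = {e}"
      | "\<forall>x\<in>X. \<exists>!y. (x, y) \<in> D" "\<forall>y\<in>Y. \<exists>!x. (x, y) \<in> D"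
      using cases True by auto
    then show ?thesis
    proof cases
      case 1
      then have "digraph_iso (with_proj G) (with_proj ?K)" using iso by (simp add: delete_edges_def)
      then show ?thesis unfolding near_complete_bipartite_def using complete_bipartite_Knn by blast
    next
      case (2 e)
      then have "map_prod h h e \<in> h ` X \<times> h ` Y" using D(1) by auto
      then have "map_prod h h e \<in> parcs ?K" using hX h(3) by (simp add: Knn_def)
      moreover have "digraph_iso (with_proj G) (with_proj (delete_edges {map_prod h h e} ?K))"
        using iso 2 by simp
      ultimately show ?thesis unfolding near_complete_bipartite_def using complete_bipartite_Knn by blast
    next
      case 3
      define D' where "D' = map_prod h h ` D"
      have D': "D' \<subseteq> {..<?n} \<times> {?n..<2 * ?n}"
        using image_mono[OF D(1)] map_prod_surj_on[OF hX h(3)] unfolding D'_def by metis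
      \<comment> \<open>Injectivity of \<open>h\<close> carries the unique-partner property from
        \<open>D\<close> to \<open>D'\<close>.\<close>
      have iff: "(h x, h y) \<in> D' \<longleftrightarrow> (x, y) \<in> D" if "x \<in> X" "y \<in> Y" for x y
      proof
        assume "(h x, h y) \<in> D'"
        then obtain x' y' where "(x', y') \<in> D" "h x = h x'" "h y = h y'" unfolding D'_def by auto
        moreover from this have "x' = x" "y' = y" using that D(1) inj_onD[OF h(1)] by blast+
        ultimately show "(x, y) \<in> D" by simp
      qed (force simp: D'_def)
      have left: "\<exists>!j. (i, j) \<in> D'" if i: "i < ?n" for i
      proof -
        obtain x where x: "x \<in> X" "i = h x" using i hX by (metis imageE lessThan_iff)
        obtain y where y: "(x, y) \<in> D" "\<And>z. (x, z) \<in> D \<Longrightarrow> z = y" using 3(1) x by blast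
        show ?thesis
        proof (rule ex1I)
          show "(i, h y) \<in> D'" using y(1) x unfolding D'_def by auto
          fix j assume j: "(i, j) \<in> D'"
          then obtain z where "z \<in> Y" "j = h z" using D' h(3) by blast
          then show "j = h y" using iff[OF x(1)] j x y by blast
        qed
      qed
      have right: "\<exists>!i. (i, j) \<in> D'" if j: "?n \<le> j" "j < 2 * ?n" for j
      proof -
        obtain y where y: "y \<in> Y" "j = h y" using j h(3) by (metis imageE atLeastLessThan_iff)
        obtain x where x: "(x, y) \<in> D" "\<And>z. (z, y) \<in> D \<Longrightarrow> z = x" using 3(2) y by blast
        show ?thesis
        proof (rule ex1I)
          show "(h x, j) \<in> D'" using x(1) y unfolding D'_def by auto
          fix i assume i: "(i, j) \<in> D'"
          then obtain z where "z \<in> X" "i = h z" using D' hX by blast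
          then show "i = h x" using iff[OF _ y(1)] i x y by blast
        qed
      qed
      \<comment> \<open>A matching must be symmetric, whereas \<open>D'\<close> only points from low
        to high labels. Low labels find their partner in \<open>D'\<close>, high ones in its
        converse.\<close>
      have "perfect_matching ?K (D' \<union> D'\<inverse>)"
        unfolding perfect_matching_def
      proof (intro conjI ballI)
        show "D' \<union> D'\<inverse> \<subseteq> parcs ?K" using D' by (auto simp: Knn_def)
        show "sym (D' \<union> D'\<inverse>)" by (rule sym_Un_converse)
        fix i assume i: "i \<in> pverts ?K"
        show "\<exists>!j. (i, j) \<in> D' \<union> D'\<inverse>"
        proof (cases "i < ?n")
          case True
          then have "(i, j) \<in> D' \<union> D'\<inverse> \<longleftrightarrow> (i, j) \<in> D'" for j using D' by auto
          then show ?thesis using left[OF True] by simp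
        next
          case False
          then have "(i, j) \<in> D' \<union> D'\<inverse> \<longleftrightarrow> (j, i) \<in> D'" for j using D' by auto
          then show ?thesis using right[of i] False i by (simp add: Knn_def)
        qed
      qed
      moreover have "delete_edges (D' \<union> D'\<inverse>) ?K = delete_edges D' ?K"
        by (simp add: delete_edges_def converse_Un Un_commute)
      then have "digraph_iso (with_proj G) (with_proj (delete_edges (D' \<union> D'\<inverse>) ?K))"
        using iso unfolding D'_def by simp
      ultimately show ?thesis unfolding near_complete_bipartite_def using complete_bipartite_Knn by blast
    qed
  qed
qed

section \<open>Assembling the classification\<close>

lemma (in bipartite_L1_max) near_complete:
  assumes G: "pair_wf_digraph G" "pverts G = X \<union> Y" and N: "N = nbhd G"
  shows "near_complete_bipartite G"
proof -
  define D where "D = {(x, y). x \<in> X \<and> y \<in> Y \<and> y \<notin> N x}"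
  have "(x, y) \<in> parcs G \<longleftrightarrow> y \<in> N x" for x y by (simp add: N nbhd_def)
  then have arcs: "parcs G = (X \<times> Y - D) \<union> (X \<times> Y - D)\<inverse>"
    using nbr_sides nbr_sym unfolding D_def by auto
  have D: "D \<subseteq> X \<times> Y" by (auto simp: D_def)
  have "D = {} \<and> card X + 1 = card Y \<or>
      card X = card Y \<and> (D = {} \<or> (\<exists>e. D = {e}) \<or>
        (\<forall>x\<in>X. \<exists>!y. (x, y) \<in> D) \<and> (\<forall>y\<in>Y. \<exists>!x. (x, y) \<in> D))"
  proof (cases "Y = N a")
    case False
    then show ?thesis using not_dominating by (simp add: D_def)
  next
    case True
    show ?thesis
    proof (cases "\<forall>x\<in>X. N x = Y")
      case True
      then have "D = {}" by (auto simp: D_def)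
      then show ?thesis using dominating[OF \<open>Y = N a\<close>] by blast
    next
      case False
      then obtain x0 y0 where "card X = card Y" "x0 \<in> X" "y0 \<in> Y"
        "\<forall>x\<in>X. \<forall>y\<in>Y. y \<in> N x \<longleftrightarrow> (x, y) \<noteq> (x0, y0)"
        using dominating[OF \<open>Y = N a\<close>] by blast
      moreover from this have "D = {(x0, y0)}" by (auto simp: D_def)
      ultimately show ?thesis by blast
    qed
  qed
  then show ?thesis using near_complete_bipartiteI[OF G finX finY disjoint D arcs] by blast
qed

theorem theorem12:
  fixes G :: "'a pair_pre_digraph"
  assumes "simple_graph G" and "locally_finite G"
    and "Digraph_Component.connected (with_proj G)"
    and "bipartite G" and "L1_graph G" and "max_degree G > 2"
  shows "\<exists>n. \<exists>K :: nat pair_pre_digraph. K\<^bsub>n,n\<^esub> (with_proj K) \<and>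
    (digraph_iso (with_proj G) (with_proj K)
     \<or> (\<exists>v\<in>pverts K. digraph_iso (with_proj G) (pre_digraph.del_vert (with_proj K) v))
     \<or> (\<exists>e\<in>parcs K. digraph_iso (with_proj G) (with_proj (delete_edges {e} K)))
     \<or> (\<exists>M. perfect_matching K M \<and> digraph_iso (with_proj G) (with_proj (delete_edges M K))))"
proof -
  interpret pair_bidirected_digraph G by fact
  obtain X Y where XY: "pverts G = X \<union> Y" "X \<inter> Y = {}" "parcs G \<subseteq> X \<times> Y \<union> Y \<times> X"
    using \<open>bipartite G\<close> unfolding bipartite_def by blast
  interpret B: bipartite_L1 X Y "nbhd G"
    using bipartite_L1_nbhd[OF assms(1-3,5) XY] .
  interpret B': bipartite_L1 Y X "nbhd G" by (rule B.swap)
  \<comment> \<open>The supremum might be infinite at this point, but exceeding 2 already needs a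
    single vertex of degree at least 3.\<close>
  obtain a where a: "a \<in> X \<union> Y" "3 \<le> card (nbhd G a)"
    using \<open>max_degree G > 2\<close> XY(1)
    by (auto simp: max_degree_def less_SUP_iff degree_def numeral_eq_enat Suc_le_eq eval_nat_numeral)
  \<comment> \<open>Only now is a maximum degree known to be attained. The swapped instance covers
    \<open>a\<close> in \<open>Y\<close>.\<close>
  then have fin: "finite (X \<union> Y)" using B.finite_sides B'.finite_sides by blast
  define m where "m = Max ((\<lambda>z. card (nbhd G z)) ` (X \<union> Y))"
  have "m \<in> (\<lambda>z. card (nbhd G z)) ` (X \<union> Y)" unfolding m_def using fin a by (intro Max_in) auto
  then obtain c where c: "c \<in> X \<union> Y" "card (nbhd G c) = m" by auto
  have max: "card (nbhd G z) \<le> card (nbhd G c)" for z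
  proof (cases "z \<in> X \<union> Y")
    case True
    then show ?thesis unfolding c(2) m_def using fin by (intro Max_ge) auto
  next
    case False
    then have "nbhd G z = {}" using B.nbr_sides by blast
    then show ?thesis by simp
  qed
  have deg: "3 \<le> card (nbhd G c)" using a(2) max[of a] by linarith
  have "near_complete_bipartite G"
  proof (cases "c \<in> X")
    case True
    then interpret M: bipartite_L1_max X Y "nbhd G" c using max deg by unfold_locales
    show ?thesis using M.near_complete[OF pair_wf_digraph_axioms XY(1)] by simp
  next
    case False
    then have "c \<in> Y" using c by blast
    then interpret M: bipartite_L1_max Y X "nbhd G" c using max deg by unfold_locales
    show ?thesis using M.near_complete[OF pair_wf_digraph_axioms] XY(1) by (simp add: Un_commute)
  qed
  then show ?thesis unfolding near_complete_bipartite_def .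
qed

end
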